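(* There is a constant $b>0$ such that for each integer $k \geq 3$ there is an infinite class $\mathbf{G}$ of graphs of maximum degree at most $5$, each of treewidth at most $k$, such that every $G \in \mathbf{G}$ has $mw(G) \geq (\log n \cdot k)/b$, where $n=|V(G)|$.
   Context: Logarithms are base 2. Matching width: for a permutation $SV$ of $V(G)$ and a prefix $S_1$ of $SV$, the matching width of $S_1$ is the size of a largest matching consisting of edges with one end in $S_1$ and the other in $V(G)\setminus S_1$; the matching width of $SV$ is the maximum matching width of its prefixes; $mw(G)$ is the minimum matching width over all permutations of $V(G)$. *)

theory Defs
  imports Complex_Main "HOL-Library.Sublist" "HOL-Combinatorics.Multiset_Permutations"
begin

record 'a ugraph =
  verts :: "'a set"
  edges :: "'a set set"

definition simple_graph :: "'a ugraph \<Rightarrow> bool" where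
  "simple_graph G \<longleftrightarrow>
     finite (verts G) \<and> verts G \<noteq> {} \<and> (\<forall>e\<in>edges G. e \<subseteq> verts G \<and> card e = 2)"

definition isomorphic :: "'a ugraph \<Rightarrow> 'b ugraph \<Rightarrow> bool" where
  "isomorphic G H \<longleftrightarrow>
     (\<exists>f. bij_betw f (verts G) (verts H) \<and>
          (\<forall>u\<in>verts G. \<forall>v\<in>verts G. {u, v} \<in> edges G \<longleftrightarrow> {f u, f v} \<in> edges H))"

definition degree :: "'a ugraph \<Rightarrow> 'a \<Rightarrow> nat" where
  "degree G v = card {e \<in> edges G. v \<in> e}"

definition max_degree :: "'a ugraph \<Rightarrow> nat" where
  "max_degree G = Max (degree G ` verts G)"

definition walk :: "'a ugraph \<Rightarrow> 'a list \<Rightarrow> bool" where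
  "walk G p \<longleftrightarrow>
     p \<noteq> [] \<and> set p \<subseteq> verts G \<and> successively (\<lambda>u v. {u, v} \<in> edges G) p"

definition connected_graph :: "'a ugraph \<Rightarrow> bool" where
  "connected_graph G \<longleftrightarrow>
     (\<forall>u\<in>verts G. \<forall>v\<in>verts G. \<exists>p. walk G p \<and> hd p = u \<and> last p = v)"

definition cycle :: "'a ugraph \<Rightarrow> 'a list \<Rightarrow> bool" where
  "cycle G p \<longleftrightarrow>
     walk G p \<and> distinct p \<and> length p \<ge> 3 \<and> {last p, hd p} \<in> edges G"

definition tree :: "'a ugraph \<Rightarrow> bool" where
  "tree T \<longleftrightarrow> simple_graph T \<and> connected_graph T \<and> (\<nexists>p. cycle T p)"

definition induced_subgraph :: "'a ugraph \<Rightarrow> 'a set \<Rightarrow> 'a ugraph" where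
  "induced_subgraph G X =
     \<lparr>verts = verts G \<inter> X, edges = {e \<in> edges G. e \<subseteq> X}\<rparr>"

definition tree_decomposition :: "'a ugraph \<Rightarrow> 'b ugraph \<Rightarrow> ('b \<Rightarrow> 'a set) \<Rightarrow> bool" where
  "tree_decomposition G T B \<longleftrightarrow>
     tree T \<and>
     (\<Union>t\<in>verts T. B t) = verts G \<and>
     (\<forall>e\<in>edges G. \<exists>t\<in>verts T. e \<subseteq> B t) \<and>
     (\<forall>v\<in>verts G. connected_graph (induced_subgraph T {t \<in> verts T. v \<in> B t}))"

definition decomposition_width :: "'b ugraph \<Rightarrow> ('b \<Rightarrow> 'a set) \<Rightarrow> nat" where
  "decomposition_width T B = Max ((\<lambda>t. card (B t)) ` verts T) - 1"

text \<open>Decomposition trees are finite, so nodes of type \<^typ>\<open>nat\<close> lose no generality.\<close>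

definition treewidth :: "'a ugraph \<Rightarrow> nat" where
  "treewidth G =
     (LEAST w. \<exists>(T :: nat ugraph) B. tree_decomposition G T B \<and> decomposition_width T B = w)"

definition matching :: "'a set set \<Rightarrow> bool" where
  "matching M \<longleftrightarrow> (\<forall>e\<in>M. \<forall>f\<in>M. e \<noteq> f \<longrightarrow> e \<inter> f = {})"

definition crossing_edges :: "'a ugraph \<Rightarrow> 'a set \<Rightarrow> 'a set set" where
  "crossing_edges G S = {e \<in> edges G. \<exists>u v. e = {u, v} \<and> u \<in> S \<and> v \<in> verts G - S}"

definition prefix_matching_width :: "'a ugraph \<Rightarrow> 'a list \<Rightarrow> nat" where
  "prefix_matching_width G S1 =
     Max {card M | M. M \<subseteq> crossing_edges G (set S1) \<and> matching M}"

definition perm_matching_width :: "'a ugraph \<Rightarrow> 'a list \<Rightarrow> nat" where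
  "perm_matching_width G SV = Max {prefix_matching_width G S1 | S1. prefix S1 SV}"

definition mw :: "'a ugraph \<Rightarrow> nat" where
  "mw G = Min (perm_matching_width G ` permutations_of_set (verts G))"

end

theory Submission
  imports Defs
begin

text \<open>The graphs are Cartesian products of a complete binary tree with a path on
  \<open>p = \<lceil>k / 2\<rceil>\<close> vertices. Tree nodes are numbered as in a heap (the root is 1, the parent
  of \<open>s\<close> is \<open>s div 2\<close>), and the \<open>i\<close>-th vertex of the path at the node \<open>t\<close> is the number
  \<open>t * p + i\<close>. Pairing the path of every node with the path of its parent gives bags of size
  \<open>2 * p\<close>. For the matching width, consider three disjoint subtrees two levels below the root and, for
  each, the moment at which its cut contains a large matching. At the middle one of these
  moments the rest of the graph is itself split into two large parts, and since its rows (copies of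
  a tree) and its columns (paths) are connected, \<open>p\<close> pairwise disjoint cut edges exist there. So two
  further levels of the tree increase the matching width by \<open>p\<close>.\<close>

section \<open>Cuts of the product of a binary tree with a path\<close>

text \<open>\<open>s div 2 ^ d\<close> is the \<open>d\<close>-th ancestor of \<open>s\<close>, so
  these are the descendants of \<open>t\<close> on \<open>h\<close> levels, the first of which is
  \<open>t\<close> itself.\<close>

definition subtree :: "nat \<Rightarrow> nat \<Rightarrow> nat set" where
  "subtree h t = {s. \<exists>d<h. s div 2 ^ d = t}"

text \<open>The relation is oriented: path edges lead to the next position, tree edges from parent
  to child. Halving fixes 0, so node 0 would carry loops; node numbers therefore start at 1.\<close>

definition adj :: "nat \<Rightarrow> nat \<Rightarrow> nat \<Rightarrow> bool" where
  "adj p v w \<longleftrightarrow> (v div p = w div p \<and> w = Suc v) \<or> (v mod p = w mod p \<and> v div p = w div p div 2)"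

definition blocks :: "nat \<Rightarrow> nat set \<Rightarrow> nat set" where
  "blocks p A = {v. v div p \<in> A}"

text \<open>Both ends must lie over \<open>A\<close>, so cuts over disjoint node sets share no
  vertex and their matchings can be united.\<close>

definition cut :: "nat \<Rightarrow> nat set \<Rightarrow> nat set \<Rightarrow> nat set set" where
  "cut p A S = {{v, w} | v w. adj p v w \<and> v \<in> blocks p A \<and> w \<in> blocks p A \<and> (v \<in> S \<longleftrightarrow> w \<notin> S)}"

lemma cut_mono: "A \<subseteq> B \<Longrightarrow> cut p A S \<subseteq> cut p B S"
  unfolding cut_def blocks_def by blast

lemma cut_subset_blocks: "e \<in> cut p A S \<Longrightarrow> e \<subseteq> blocks p A \<and> e \<noteq> {}"
  unfolding cut_def by blast

lemma finite_blocks: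
  assumes "p > 0" "finite A"
  shows "finite (blocks p A)" and "card (blocks p A) = card A * p"
proof -
  have bij: "bij_betw (\<lambda>v. (v div p, v mod p)) (blocks p A) (A \<times> {..<p})"
    by (rule bij_betw_byWitness[where f' = "\<lambda>(c, i). c * p + i"])
       (use assms in \<open>auto simp: blocks_def\<close>)
  show "finite (blocks p A)" using bij_betw_finite[OF bij] assms(2) by simp
  show "card (blocks p A) = card A * p"
    using bij_betw_same_card[OF bij] by (simp add: card_cartesian_product)
qed

section \<open>Disjoint edges and unions of matchings\<close>

text \<open>Edges lying wholly in different classes are disjoint and, being nonempty, distinct. The
  classes will be rows (\<open>v mod p\<close>) or columns (\<open>v div p\<close>).\<close>

lemma matching_from_classes:
  assumes "\<And>i. i \<in> I \<Longrightarrow> \<exists>e\<in>C. e \<noteq> {} \<and> (\<forall>v\<in>e. cl v = i)"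
  shows "\<exists>M\<subseteq>C. matching M \<and> card M = card I"
proof -
  have "\<forall>i\<in>I. \<exists>e. e \<in> C \<and> e \<noteq> {} \<and> (\<forall>v\<in>e. cl v = i)" using assms by blast
  from bchoice[OF this] obtain e
    where e: "\<forall>i\<in>I. e i \<in> C \<and> e i \<noteq> {} \<and> (\<forall>v\<in>e i. cl v = i)" by blast
  have disj: "i = j" if "i \<in> I" "j \<in> I" "v \<in> e i" "v \<in> e j" for i j v
  proof -
    have "cl v = i" using e that(1,3) by blast
    moreover have "cl v = j" using e that(2,4) by blast
    ultimately show ?thesis by simp
  qed
  have "inj_on e I"
  proof (rule inj_onI)
    fix i j assume "i \<in> I" "j \<in> I" "e i = e j"
    moreover obtain v where "v \<in> e i" using e \<open>i \<in> I\<close> by blast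
    ultimately show "i = j" using disj by simp
  qed
  then have "card (e ` I) = card I" by (rule card_image)
  moreover have "matching (e ` I)" unfolding matching_def
  proof (intro ballI impI)
    fix x y assume "x \<in> e ` I" "y \<in> e ` I" "x \<noteq> y"
    then obtain i j where "x = e i" "y = e j" "i \<in> I" "j \<in> I" "i \<noteq> j" by blast
    with disj[of i j] show "x \<inter> y = {}" by blast
  qed
  moreover have "e ` I \<subseteq> C" using e by blast
  ultimately show ?thesis by blast
qed

lemma matching_Un:
  assumes "matching M" "matching N" "\<Union>M \<subseteq> A" "\<Union>N \<subseteq> B" "A \<inter> B = {}"
  shows "matching (M \<union> N)"
  unfolding matching_def
proof (intro ballI impI)
  fix e f assume *: "e \<in> M \<union> N" "f \<in> M \<union> N" "e \<noteq> f"
  have MN: "e \<inter> f = {}" if "e \<in> M" "f \<in> N" for e f using that assms(3-5) by blast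
  consider "e \<in> M" "f \<in> M" | "e \<in> N" "f \<in> N" | "e \<in> M" "f \<in> N" | "e \<in> N" "f \<in> M"
    using * by blast
  then show "e \<inter> f = {}"
  proof cases
    case 1 with assms(1) *(3) show ?thesis by (simp add: matching_def)
  next
    case 2 with assms(2) *(3) show ?thesis by (simp add: matching_def)
  next
    case 3 then show ?thesis by (rule MN)
  next
    case 4 then show ?thesis using MN[of f e] by (simp add: Int_commute)
  qed
qed

section \<open>Rows and columns of the product\<close>

lemma switch_exists:
  fixes i j p :: nat
  assumes "i < p" "j < p" "P i" "\<not> P j"
  shows "\<exists>l. Suc l < p \<and> (P l \<longleftrightarrow> \<not> P (Suc l))"
proof (rule ccontr)
  assume *: "\<not> ?thesis"
  have "l < p \<Longrightarrow> P l = P 0" for l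
  proof (induction l)
    case (Suc l)
    then have "P l = P (Suc l)" using * by blast
    with Suc show ?case by simp
  qed simp
  with assms show False by blast
qed

text \<open>A column is a path: between a vertex in \<open>S\<close> and one outside, some
  consecutive pair changes sides.\<close>

lemma column_edge:
  assumes p: "p > 0" and c: "c \<in> A" and v: "v div p = c" "v \<in> S" and w: "w div p = c" "w \<notin> S"
  shows "\<exists>e\<in>cut p A S. e \<noteq> {} \<and> (\<forall>x\<in>e. x div p = c)"
proof -
  have vw: "c * p + v mod p = v" "c * p + w mod p = w" using v w by (metis div_mult_mod_eq)+
  obtain l where l: "Suc l < p" "c * p + l \<in> S \<longleftrightarrow> c * p + Suc l \<notin> S"
    using switch_exists[of "v mod p" p "w mod p" "\<lambda>i. c * p + i \<in> S"] vw v w p by auto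
  have d: "(c * p + l) div p = c" "(c * p + Suc l) div p = c"
    using l(1) by (simp_all add: div_nat_eqI algebra_simps)
  have "{c * p + l, c * p + Suc l} \<in> cut p A S"
    unfolding cut_def blocks_def adj_def mem_Collect_eq
    by (intro exI[of _ "c * p + l"] exI[of _ "c * p + Suc l"]) (use l(2) c in \<open>simp only: d, simp\<close>)
  then show ?thesis by (rule bexI[rotated]) (use d in blast)
qed

text \<open>Following parents from \<open>s\<close> stays in \<open>R\<close> and, as 0 is avoided,
  strictly decreases until \<open>t\<close> is reached. Applied to a row over \<open>R\<close>:
  without cut edges it is monochromatic.\<close>

lemma constant_on_tree:
  assumes "\<And>s. s \<in> R \<Longrightarrow> s \<noteq> t \<Longrightarrow> s div 2 \<in> R" "(0::nat) \<notin> R"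
    and "\<And>s. s \<in> R \<Longrightarrow> s \<noteq> t \<Longrightarrow> f s = f (s div 2)"
  shows "s \<in> R \<Longrightarrow> f s = f t"
proof (induction s rule: less_induct)
  case (less s)
  show ?case
  proof (cases "s = t")
    case False
    have "s div 2 < s" using less.prems assms(2) by (cases s) auto
    then have "f (s div 2) = f t" using less.IH assms(1)[OF less.prems False] by blast
    then show ?thesis using assms(3)[OF less.prems False] by simp
  qed simp
qed

text \<open>A column holds only \<open>p\<close> vertices, so \<open>p * p\<close> vertices occupy
  at least \<open>p\<close> columns, each supplying an edge of its own.\<close>

lemma many_columns:
  assumes p: "p > 0" and X: "p * p \<le> card X"
    and mixed: "\<And>v. v \<in> X \<Longrightarrow> \<exists>e\<in>C. e \<noteq> {} \<and> (\<forall>x\<in>e. x div p = v div p)"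
  shows "\<exists>M\<subseteq>C. matching M \<and> card M = p"
proof -
  define K where "K = (\<lambda>v. v div p) ` X"
  have "finite X" by (rule card_ge_0_finite, rule less_le_trans[OF _ X]) (use p in simp)
  then have finK: "finite K" unfolding K_def by simp
  have "card X \<le> card (blocks p K)"
    by (rule card_mono[OF finite_blocks(1)[OF p finK]]) (simp add: blocks_def K_def subset_iff)
  then have "p * p \<le> card K * p" using X finite_blocks(2)[OF p finK] by linarith
  then have "p \<le> card K" using p by simp
  then obtain I where I: "I \<subseteq> K" "card I = p" by (meson obtain_subset_with_card_n)
  have "\<exists>M\<subseteq>C. matching M \<and> card M = card I"
  proof (rule matching_from_classes[where cl = "\<lambda>v. v div p"])
    fix i assume "i \<in> I"
    then obtain v where "v \<in> X" "i = v div p" using I(1) K_def by blast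
    then show "\<exists>e\<in>C. e \<noteq> {} \<and> (\<forall>x\<in>e. x div p = i)" using mixed by simp
  qed
  then show ?thesis using I by simp
qed

text \<open>If no row is monochromatic, every row contributes an edge; otherwise every column containing
  the colour opposite to that of a monochromatic row contributes one.\<close>

lemma matching_across_balanced_cut:
  assumes p: "p > 0"
    and R: "t \<in> R" "\<And>s. s \<in> R \<Longrightarrow> s \<noteq> t \<Longrightarrow> s div 2 \<in> R" "0 \<notin> R"
    and inside: "p * p \<le> card (blocks p R \<inter> S)" and outside: "p * p \<le> card (blocks p R - S)"
  shows "\<exists>M\<subseteq>cut p R S. matching M \<and> card M = p"
proof (cases "\<forall>i<p. \<exists>e\<in>cut p R S. e \<noteq> {} \<and> (\<forall>v\<in>e. v mod p = i)")
  case True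
  then have "\<exists>M\<subseteq>cut p R S. matching M \<and> card M = card {..<p}"
    by (intro matching_from_classes[where cl = "\<lambda>v. v mod p"]) blast
  then show ?thesis by simp
next
  case False
  then obtain i where i: "i < p" "\<not> (\<exists>e\<in>cut p R S. e \<noteq> {} \<and> (\<forall>v\<in>e. v mod p = i))" by blast
  have d: "(c * p + i) div p = c" "(c * p + i) mod p = i" for c using i by simp_all
  have const: "(s * p + i \<in> S) = (t * p + i \<in> S)" if "s \<in> R" for s
  proof (rule constant_on_tree[where R = R and f = "\<lambda>s. s * p + i \<in> S"])
    fix s assume s: "s \<in> R" "s \<noteq> t"
    show "(s * p + i \<in> S) = (s div 2 * p + i \<in> S)"
    proof (rule ccontr)
      assume *: "\<not> ?thesis"
      have "adj p (s div 2 * p + i) (s * p + i)" unfolding adj_def by (simp only: d simp_thms)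
      moreover have "s div 2 * p + i \<in> blocks p R" "s * p + i \<in> blocks p R"
        unfolding blocks_def mem_Collect_eq d using s(1) R(2)[OF s] by blast+
      ultimately have "{s div 2 * p + i, s * p + i} \<in> cut p R S"
        unfolding cut_def using * by blast
      moreover have "\<forall>v\<in>{s div 2 * p + i, s * p + i}. v mod p = i" using d(2) by blast
      moreover have "{s div 2 * p + i, s * p + i} \<noteq> {}" by (rule insert_not_empty)
      ultimately show False using i(2) by (iprover intro: bexI conjI)
    qed
  qed (fact R(2) R(3) that)+
  show ?thesis
  proof (cases "t * p + i \<in> S")
    case True
    show ?thesis
    proof (rule many_columns[OF p outside])
      fix v assume v: "v \<in> blocks p R - S"
      then have "v div p \<in> R" "v \<notin> S" by (simp_all add: blocks_def)
      with const True have "v div p * p + i \<in> S" by blast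
      from column_edge[OF p \<open>v div p \<in> R\<close> d(1) this refl \<open>v \<notin> S\<close>]
      show "\<exists>e\<in>cut p R S. e \<noteq> {} \<and> (\<forall>x\<in>e. x div p = v div p)" .
    qed
  next
    case False
    show ?thesis
    proof (rule many_columns[OF p inside])
      fix v assume v: "v \<in> blocks p R \<inter> S"
      then have "v div p \<in> R" "v \<in> S" by (simp_all add: blocks_def)
      with const False have "v div p * p + i \<notin> S" by blast
      from column_edge[OF p \<open>v div p \<in> R\<close> refl \<open>v \<in> S\<close> d(1) this]
      show "\<exists>e\<in>cut p R S. e \<noteq> {} \<and> (\<forall>x\<in>e. x div p = v div p)" .
    qed
  qed
qed

section \<open>Truncated subtrees in the heap numbering\<close>

text \<open>Reached at two depths, \<open>t\<close> would be a proper ancestor of itself, but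
  halving a positive number decreases it. Depth below \<open>t\<close> is thus well defined, which
  is what separates subtrees later.\<close>

lemma depth_unique:
  fixes s t :: nat
  assumes "s div 2 ^ d = t" "s div 2 ^ e = t" "t > 0"
  shows "d = e"
proof -
  have less: False if "a < b" "s div 2 ^ a = t" "s div 2 ^ b = t" for a b
  proof -
    have "s div 2 ^ b = s div 2 ^ a div 2 ^ (b - a)"
      using that(1) by (simp add: div_mult2_eq[symmetric] power_add[symmetric])
    then have "t = t div 2 ^ (b - a)" using that by simp
    moreover have "(1::nat) < 2 ^ (b - a)" using that(1) by (intro one_less_power) auto
    ultimately show False using assms(3) by (metis div_less_dividend less_irrefl)
  qed
  show ?thesis using less[of d e] less[of e d] assms by (meson linorder_neqE_nat)
qed

lemma zero_notin_subtree: "t > 0 \<Longrightarrow> 0 \<notin> subtree h t"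
  by (auto simp: subtree_def)

lemma finite_subtree: "t > 0 \<Longrightarrow> finite (subtree h t)"
proof -
  assume t: "t > 0"
  have "subtree h t \<subseteq> {..<(t + 1) * 2 ^ h}"
  proof
    fix s assume "s \<in> subtree h t"
    then obtain d where d: "d < h" "s div 2 ^ d = t" by (auto simp: subtree_def)
    have "s < (t + 1) * 2 ^ d" using d(2) div_less_iff_less_mult[of "2 ^ d" s "t + 1"] by simp
    also have "\<dots> \<le> (t + 1) * 2 ^ h" using d by (intro mult_left_mono power_increasing) auto
    finally show "s \<in> {..<(t + 1) * 2 ^ h}" by simp
  qed
  then show ?thesis by (rule finite_subset) simp
qed

text \<open>The bottom level alone has \<open>2 ^ h\<close> nodes, numbered from
  \<open>t * 2 ^ h\<close> on.\<close>

lemma card_subtree: "t > 0 \<Longrightarrow> 2 ^ h \<le> card (subtree (Suc h) t)"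
proof -
  assume t: "t > 0"
  have "{t * 2 ^ h..<t * 2 ^ h + 2 ^ h} \<subseteq> subtree (Suc h) t"
    unfolding subtree_def by (auto intro!: exI[of _ h] div_nat_eqI simp: algebra_simps)
  from card_mono[OF finite_subtree[OF t] this] show ?thesis by simp
qed

lemma div_pow2_div_4: "(s::nat) div 2 ^ (d + 2) = s div 2 ^ d div 4"
  using div_mult2_eq[of s "2 ^ d" 4] by (simp add: power_add mult.commute)

lemma subtree_grandchild:
  assumes "b div 4 = t"
  shows "subtree h b \<subseteq> subtree (h + 2) t"
proof
  fix s assume "s \<in> subtree h b"
  then obtain d where d: "d < h" "s div 2 ^ d = b" by (auto simp: subtree_def)
  have "s div 2 ^ (d + 2) = t"
    using d(2) assms by (simp only: div_pow2_div_4)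
  then show "s \<in> subtree (h + 2) t" using d(1) by (auto simp: subtree_def intro!: exI[of _ "d + 2"])
qed

text \<open>A node below both would have the same depth below \<open>t\<close> through each of them,
  hence the same ancestor two levels under \<open>t\<close>.\<close>

lemma subtree_grandchildren_disjoint:
  assumes "a div 4 = t" "b div 4 = t" "t > 0" "a \<noteq> b"
  shows "subtree h a \<inter> subtree h b = {}"
proof (rule ccontr)
  assume "\<not> ?thesis"
  then obtain s d e where *: "s div 2 ^ d = a" "s div 2 ^ e = b" by (auto simp: subtree_def)
  have "s div 2 ^ (d + 2) = t" "s div 2 ^ (e + 2) = t"
    using * assms by (simp_all only: div_pow2_div_4)
  then have "d + 2 = e + 2" using assms(3) by (rule depth_unique)
  with * assms(4) show False by simp
qed

text \<open>What remains after removing a grandchild's subtree is still closed under parents up to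
  \<open>t\<close>, so its rows stay connected.\<close>

lemma subtree_minus_closed:
  assumes b: "b div 4 = t" "t > 0" and s: "s \<in> subtree (h + 2) t - subtree h b" "s \<noteq> t"
  shows "s div 2 \<in> subtree (h + 2) t - subtree h b"
proof
  obtain d where d: "d < h + 2" "s div 2 ^ d = t" using s by (auto simp: subtree_def)
  then obtain d' where d': "d = Suc d'" using s(2) by (cases d) auto
  then have "s div 2 div 2 ^ d' = t" using d(2) by (simp add: div_mult2_eq)
  then show "s div 2 \<in> subtree (h + 2) t" using d(1) d' by (auto simp: subtree_def intro!: exI[of _ d'])
  show "s div 2 \<notin> subtree h b"
  proof
    assume "s div 2 \<in> subtree h b"
    then obtain e where e: "s div 2 ^ Suc e = b" by (auto simp: subtree_def div_mult2_eq)
    then have "s div 2 ^ (Suc e + 2) = t" using b by (simp only: div_pow2_div_4)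
    \<comment> \<open>Both subtrees end at the same level, so \<open>d < h + 2\<close> gives
      \<open>Suc e < h\<close>: within the larger subtree, a child of a removed node is removed
      too.\<close>
    then have "Suc e + 2 = d" using d(2) b(2) by (rule depth_unique)
    then have "s \<in> subtree h b" using e d(1) by (auto simp: subtree_def intro!: exI[of _ "Suc e"])
    with s show False by simp
  qed
qed

section \<open>Ordering moments and counting along prefixes\<close>

lemma sort_three:
  fixes f :: "nat \<Rightarrow> nat"
  assumes "x \<noteq> y" "y \<noteq> z" "x \<noteq> z"
  shows "\<exists>a b c. {a, b, c} = {x, y, z} \<and> a \<noteq> b \<and> b \<noteq> c \<and> f a \<le> f b \<and> f b \<le> f c"
proof -
  consider "f x \<le> f y \<and> f y \<le> f z" | "f x \<le> f z \<and> f z \<le> f y" | "f y \<le> f x \<and> f x \<le> f z"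
    | "f y \<le> f z \<and> f z \<le> f x" | "f z \<le> f x \<and> f x \<le> f y" | "f z \<le> f y \<and> f y \<le> f x"
    by linarith
  then show ?thesis
  proof cases
    case 1 then show ?thesis using assms by (intro exI[of _ x] exI[of _ y] exI[of _ z]) auto
  next
    case 2 then show ?thesis using assms by (intro exI[of _ x] exI[of _ z] exI[of _ y]) auto
  next
    case 3 then show ?thesis using assms by (intro exI[of _ y] exI[of _ x] exI[of _ z]) auto
  next
    case 4 then show ?thesis using assms by (intro exI[of _ y] exI[of _ z] exI[of _ x]) auto
  next
    case 5 then show ?thesis using assms by (intro exI[of _ z] exI[of _ x] exI[of _ y]) auto
  next
    case 6 then show ?thesis using assms by (intro exI[of _ z] exI[of _ y] exI[of _ x]) auto
  qed
qed

text \<open>Each further entry raises the count by at most one, so the first prefix that reaches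
  \<open>m\<close> cannot overshoot it.\<close>

lemma prefix_hits_exactly:
  assumes "m \<le> card X" "X \<subseteq> set xs"
  shows "\<exists>n. card (X \<inter> set (take n xs)) = m"
proof -
  define f where "f n = card (X \<inter> set (take n xs))" for n
  have step: "f (Suc n) \<le> Suc (f n)" for n
  proof (cases "n < length xs")
    case True
    then have "X \<inter> set (take (Suc n) xs) \<subseteq> insert (xs ! n) (X \<inter> set (take n xs))"
      by (auto simp: take_Suc_conv_app_nth)
    then have "f (Suc n) \<le> card (insert (xs ! n) (X \<inter> set (take n xs)))"
      unfolding f_def by (intro card_mono) auto
    also have "\<dots> \<le> Suc (f n)" unfolding f_def by (rule card_insert_le_m1) auto
    finally show ?thesis .
  qed (simp add: f_def)
  define n where "n = (LEAST n. m \<le> f n)"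
  have "m \<le> f (length xs)" using assms unfolding f_def by (simp add: Int_absorb2)
  then have n: "m \<le> f n" "\<And>k. k < n \<Longrightarrow> \<not> m \<le> f k"
    unfolding n_def using LeastI not_less_Least by metis+
  have "f n \<le> m"
  proof (cases n)
    case 0 then show ?thesis by (simp add: f_def)
  next
    case (Suc k) then show ?thesis using n(2)[of k] step[of k] by auto
  qed
  with n show ?thesis unfolding f_def by (metis le_antisym)
qed

text \<open>The requirement of \<open>p\<^sup>2\<close> vertices on both sides is what makes the induction work: of three
  disjoint subtrees with cuts found at times \<open>n\<^sub>a \<le> n\<^sub>b \<le> n\<^sub>c\<close>, the first provides
  vertices inside and the last vertices outside at time \<open>n\<^sub>b\<close>, so that the part of the graph
  away from the middle subtree is balanced and contributes \<open>p\<close> further edges.\<close>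

lemma large_matching_in_some_prefix:
  assumes p: "p > 0"
  shows "t > 0 \<Longrightarrow> blocks p (subtree (p + 1 + 2 * j) t) \<subseteq> set xs \<Longrightarrow>
    \<exists>n. (\<exists>M\<subseteq>cut p (subtree (p + 1 + 2 * j) t) (set (take n xs)). matching M \<and> card M = p * j) \<and>
      p * p \<le> card (blocks p (subtree (p + 1 + 2 * j) t) \<inter> set (take n xs)) \<and>
      p * p \<le> card (blocks p (subtree (p + 1 + 2 * j) t) - set (take n xs))"
proof (induction j arbitrary: t)
  case 0
  let ?X = "blocks p (subtree (p + 1) t)"
  have finX: "finite ?X" using finite_blocks(1)[OF p finite_subtree] 0 by blast
  \<comment> \<open>The base height \<open>p + 1\<close> is chosen for this: \<open>2 ^ p\<close>
    nodes on the bottom level give at least \<open>2 * p * p\<close> vertices, so a prefix taking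
    exactly \<open>p * p\<close> of them leaves as many outside.\<close>
  have "2 * p \<le> (2::nat) ^ p"
    using p by (induction p rule: nat_induct_non_zero) auto
  also have "\<dots> \<le> card (subtree (p + 1) t)" using card_subtree[of t p] 0 by simp
  finally have "2 * p * p \<le> card ?X"
    using finite_blocks(2)[OF p finite_subtree, of t] 0 by simp
  then obtain n where n: "card (?X \<inter> set (take n xs)) = p * p"
    using prefix_hits_exactly[of "p * p" ?X xs] 0 by auto
  have "card (?X - set (take n xs)) = card ?X - p * p"
    using card_Diff_subset_Int[of ?X "set (take n xs)"] n finX by simp
  then have "p * p \<le> card (?X - set (take n xs))" using \<open>2 * p * p \<le> card ?X\<close> by simp
  moreover have "\<exists>M\<subseteq>cut p (subtree (p + 1) t) (set (take n xs)). matching M \<and> card M = 0"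
    by (intro exI[of _ "{}"]) (simp add: matching_def)
  ultimately show ?case using n unfolding mult_0_right add_0_right by (metis order_refl)
next
  case (Suc j)
  define h where "h = p + 1 + 2 * j"
  define U where "U = subtree (h + 2) t"
  have hS: "p + 1 + 2 * Suc j = h + 2" by (simp add: h_def)
  note prems = Suc.prems[unfolded hS, folded U_def]
  define good where "good s n \<longleftrightarrow>
    (\<exists>M\<subseteq>cut p (subtree h s) (set (take n xs)). matching M \<and> card M = p * j) \<and>
      p * p \<le> card (blocks p (subtree h s) \<inter> set (take n xs)) \<and>
      p * p \<le> card (blocks p (subtree h s) - set (take n xs))" for s n
  have sub: "subtree h s \<subseteq> U" if "s div 4 = t" for s
    unfolding U_def by (rule subtree_grandchild[OF that])
  have "\<exists>n. good s n" if "s div 4 = t" for s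
    unfolding good_def h_def
  proof (rule Suc.IH)
    show "s > 0" using that prems by (cases s) auto
    show "blocks p (subtree (p + 1 + 2 * j) s) \<subseteq> set xs"
      using sub[OF that] prems(2) by (auto simp: h_def blocks_def)
  qed
  then obtain time where time: "\<And>s. s div 4 = t \<Longrightarrow> good s (time s)" by metis
  \<comment> \<open>Three of the four grandchildren of \<open>t\<close>, named so that the good
    moment of \<open>b\<close> is the middle one.\<close>
  obtain a b c where abc: "{a, b, c} = {4 * t, 4 * t + 1, 4 * t + 2}" "a \<noteq> b" "b \<noteq> c"
      "time a \<le> time b" "time b \<le> time c"
    using sort_three[of "4 * t" "4 * t + 1" "4 * t + 2" time] by auto
  have "\<forall>s\<in>{a, b, c}. s div 4 = t" unfolding abc(1) by auto
  then have q: "a div 4 = t" "b div 4 = t" "c div 4 = t" by auto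
  define S where "S = set (take (time b) xs)"
  define R where "R = U - subtree h b"
  have finU: "finite U" unfolding U_def by (rule finite_subtree[OF prems(1)])
  then have fin: "finite (blocks p U)" "finite (blocks p R)"
    using finite_blocks(1)[OF p] by (auto simp: R_def)
  have aR: "subtree h a \<subseteq> R" and cR: "subtree h c \<subseteq> R"
    using sub[OF q(1)] sub[OF q(3)] subtree_grandchildren_disjoint[OF q(1,2) prems(1) abc(2), of h]
      subtree_grandchildren_disjoint[OF q(2,3) prems(1) abc(3), of h] unfolding R_def by blast+
  \<comment> \<open>Prefixes only grow: vertices inside at \<open>time a\<close> are still inside at
    \<open>time b\<close>, and those outside at \<open>time c\<close> are outside at
    \<open>time b\<close> as well.\<close>
  have "p * p \<le> card (blocks p (subtree h a) \<inter> set (take (time a) xs))"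
    using time[OF q(1)] by (simp add: good_def)
  also have "\<dots> \<le> card (blocks p R \<inter> S)"
    using aR set_take_subset_set_take[OF abc(4), of xs] fin
    by (intro card_mono) (auto simp: S_def blocks_def)
  finally have inside: "p * p \<le> card (blocks p R \<inter> S)" .
  have "p * p \<le> card (blocks p (subtree h c) - set (take (time c) xs))"
    using time[OF q(3)] by (simp add: good_def)
  also have "\<dots> \<le> card (blocks p R - S)"
    using cR set_take_subset_set_take[OF abc(5), of xs] fin
    by (intro card_mono) (auto simp: S_def blocks_def)
  finally have outside: "p * p \<le> card (blocks p R - S)" .
  have tR: "t \<in> R"
  proof -
    have "t \<in> U" by (auto simp: U_def subtree_def intro!: exI[of _ 0])
    moreover have "t \<notin> subtree h b"
    proof
      assume "t \<in> subtree h b"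
      then obtain d where "t div 2 ^ d = b" by (auto simp: subtree_def)
      \<comment> \<open>Ancestors of \<open>t\<close> are at most \<open>t\<close>, whereas its
        grandchild \<open>b\<close> is at least \<open>4 * t\<close>.\<close>
      then have "b \<le> t" using div_le_dividend by blast
      with q(2) prems(1) show False by auto
    qed
    ultimately show ?thesis by (simp add: R_def)
  qed
  obtain N where N: "N \<subseteq> cut p R S" "matching N" "card N = p"
  proof -
    have "\<exists>M\<subseteq>cut p R S. matching M \<and> card M = p"
    proof (rule matching_across_balanced_cut[OF p tR _ _ inside outside])
      show "s div 2 \<in> R" if "s \<in> R" "s \<noteq> t" for s
        using subtree_minus_closed[OF q(2) prems(1), of s h] that by (simp add: R_def U_def)
      show "0 \<notin> R" using zero_notin_subtree[OF prems(1)] by (simp add: R_def U_def)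
    qed
    then show ?thesis using that by blast
  qed
  obtain M where M: "M \<subseteq> cut p (subtree h b) S" "matching M" "card M = p * j"
    using time[OF q(2)] by (auto simp: good_def S_def)
  have MA: "\<Union>M \<subseteq> blocks p (subtree h b)" and NB: "\<Union>N \<subseteq> blocks p R"
    using M(1) N(1) cut_subset_blocks by blast+
  have disj: "blocks p (subtree h b) \<inter> blocks p R = {}" by (auto simp: blocks_def R_def)
  have "matching (M \<union> N)" by (rule matching_Un[OF M(2) N(2) MA NB disj])
  moreover have "M \<union> N \<subseteq> cut p U S"
    using M(1) N(1) cut_mono[OF sub[OF q(2)], of p S] cut_mono[of R U p S] R_def by blast
  moreover have "card (M \<union> N) = p * Suc j"
  proof -
    have "finite (blocks p (subtree h b))"
      by (rule finite_subset[OF _ fin(1)]) (use sub[OF q(2)] in \<open>auto simp: blocks_def\<close>)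
    then have "finite M" "finite N"
      using finite_UnionD[OF finite_subset[OF MA]] finite_UnionD[OF finite_subset[OF NB fin(2)]]
      by blast+
    \<comment> \<open>The two regions are disjoint, so a common edge would have to be empty.\<close>
    moreover have "M \<inter> N = {}"
    proof (rule ccontr)
      assume "M \<inter> N \<noteq> {}"
      then obtain e where e: "e \<in> M" "e \<in> N" by blast
      then have "e \<noteq> {}" using cut_subset_blocks M(1) by blast
      with e MA NB disj show False by blast
    qed
    ultimately show ?thesis using M(3) N(3) by (simp add: card_Un_disjoint)
  qed
  moreover have "p * p \<le> card (blocks p U \<inter> S)"
    by (rule order_trans[OF inside card_mono]) (use fin in \<open>auto simp: blocks_def R_def\<close>)
  moreover have "p * p \<le> card (blocks p U - S)"
    by (rule order_trans[OF outside card_mono]) (use fin in \<open>auto simp: blocks_def R_def\<close>)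
  ultimately show ?case unfolding hS U_def S_def by blast
qed

section \<open>The graphs\<close>

definition tree_path :: "nat \<Rightarrow> nat \<Rightarrow> nat ugraph" where
  "tree_path h p = \<lparr>verts = blocks p {1..<2 ^ h},
     edges = {{v, w} | v w. adj p v w \<and> v \<in> blocks p {1..<2 ^ h} \<and> w \<in> blocks p {1..<2 ^ h}}\<rparr>"

definition heap_tree :: "nat \<Rightarrow> nat ugraph" where
  "heap_tree h = \<lparr>verts = {1..<2 ^ h}, edges = {{s, s div 2} | s. s \<in> {2..<2 ^ h}}\<rparr>"

section \<open>Lower bound on the matching width, and the degrees\<close>

lemma finite_edges: "simple_graph G \<Longrightarrow> finite (edges G)"
  unfolding simple_graph_def by (rule finite_subset[of _ "Pow (verts G)"]) auto

lemma mw_geI: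
  assumes G: "simple_graph G"
    and large: "\<And>xs. distinct xs \<Longrightarrow> set xs = verts G \<Longrightarrow>
      \<exists>n. \<exists>M\<subseteq>crossing_edges G (set (take n xs)). matching M \<and> card M = m"
  shows "m \<le> mw G"
  unfolding mw_def
proof (rule Min.boundedI)
  have "finite (verts G)" using G by (simp add: simple_graph_def)
  then show "finite (perm_matching_width G ` permutations_of_set (verts G))"
    "perm_matching_width G ` permutations_of_set (verts G) \<noteq> {}" by auto
  fix a assume "a \<in> perm_matching_width G ` permutations_of_set (verts G)"
  then obtain xs where xs: "a = perm_matching_width G xs" "set xs = verts G" "distinct xs"
    by (auto simp: permutations_of_set_def)
  then obtain n M where M: "M \<subseteq> crossing_edges G (set (take n xs))" "matching M" "card M = m"
    using large by blast
  have "{M. M \<subseteq> crossing_edges G (set (take n xs)) \<and> matching M} \<subseteq> Pow (edges G)"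
    by (auto simp: crossing_edges_def)
  then have "finite {M. M \<subseteq> crossing_edges G (set (take n xs)) \<and> matching M}"
    using finite_edges[OF G] finite_subset by blast
  then have "m \<le> prefix_matching_width G (take n xs)"
    unfolding prefix_matching_width_def by (intro Max_ge) (use M in auto)
  also have "\<dots> \<le> a"
    unfolding xs(1) perm_matching_width_def
  proof (rule Max_ge)
    have "{prefix_matching_width G S1 | S1. prefix S1 xs} = prefix_matching_width G ` set (prefixes xs)"
      by (auto simp: in_set_prefixes)
    then show "finite {prefix_matching_width G S1 | S1. prefix S1 xs}" by simp
    show "prefix_matching_width G (take n xs) \<in> {prefix_matching_width G S1 | S1. prefix S1 xs}"
      using take_is_prefix by blast
  qed
  finally show "m \<le> a" .
qed

text \<open>Equal ends would force \<open>v div p = 0\<close>, and node 0 is excluded.\<close>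

lemma adj_neq: "adj p v w \<Longrightarrow> v \<in> blocks p {1..<n} \<Longrightarrow> v \<noteq> w"
  by (auto simp: adj_def blocks_def)

lemma simple_tree_path:
  assumes "p > 0" "h > 0"
  shows "simple_graph (tree_path h p)"
proof -
  have "(1::nat) < 2 ^ h" using assms(2) by (intro one_less_power) auto
  then have "p \<in> blocks p {1..<2 ^ h}" using assms(1) by (simp add: blocks_def)
  then show ?thesis
    unfolding simple_graph_def tree_path_def
    using finite_blocks(1)[OF assms(1)] adj_neq by (auto simp: card_insert_if)
qed

lemma subtree_root: "subtree h 1 \<subseteq> {1..<2 ^ h}"
proof
  fix s assume "s \<in> subtree h 1"
  then obtain d where d: "d < h" "s div 2 ^ d = 1" by (auto simp: subtree_def)
  have "s < 2 * 2 ^ d" using d(2) div_less_iff_less_mult[of "2 ^ d" s 2] by simp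
  also have "\<dots> \<le> (2::nat) ^ h" using power_increasing[of "Suc d" h "2::nat"] d(1) by simp
  finally have "s < 2 ^ h" .
  moreover have "s \<noteq> 0" using d(2) by (intro notI) simp
  ultimately show "s \<in> {1..<2 ^ h}" by simp
qed

lemma mw_tree_path:
  assumes p: "p > 0"
  shows "p * j \<le> mw (tree_path (p + 1 + 2 * j) p)"
proof (rule mw_geI)
  show "simple_graph (tree_path (p + 1 + 2 * j) p)" by (rule simple_tree_path) (use p in auto)
next
  let ?h = "p + 1 + 2 * j"
  fix xs assume xs: "set xs = verts (tree_path ?h p)"
  have "blocks p (subtree ?h 1) \<subseteq> set xs"
    using subtree_root[of ?h] unfolding xs tree_path_def blocks_def by auto
  from large_matching_in_some_prefix[OF p zero_less_one this]
  obtain n M where M: "M \<subseteq> cut p (subtree ?h 1) (set (take n xs))" "matching M" "card M = p * j"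
    by blast
  have "cut p {1..<2 ^ ?h} S \<subseteq> crossing_edges (tree_path ?h p) S" for S
  proof
    fix e assume "e \<in> cut p {1..<2 ^ ?h} S"
    then obtain v w where e: "e = {v, w}" "adj p v w" "v \<in> blocks p {1..<2 ^ ?h}"
      "w \<in> blocks p {1..<2 ^ ?h}" "v \<in> S \<longleftrightarrow> w \<notin> S"
      unfolding cut_def by blast
    then have "e \<in> edges (tree_path ?h p)" unfolding tree_path_def by auto
    moreover have "\<exists>u v. e = {u, v} \<and> u \<in> S \<and> v \<in> verts (tree_path ?h p) - S"
    proof (cases "v \<in> S")
      case True
      then show ?thesis using e by (intro exI[of _ v] exI[of _ w]) (simp add: tree_path_def)
    next
      case False
      then show ?thesis using e
        by (intro exI[of _ w] exI[of _ v]) (simp add: tree_path_def insert_commute)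
    qed
    ultimately show "e \<in> crossing_edges (tree_path ?h p) S" unfolding crossing_edges_def by blast
  qed
  then show "\<exists>n. \<exists>M\<subseteq>crossing_edges (tree_path ?h p) (set (take n xs)). matching M \<and> card M = p * j"
    using M cut_mono[OF subtree_root] by (meson order_trans)
qed

lemma max_degree_tree_path:
  assumes "p > 0" "h > 0"
  shows "max_degree (tree_path h p) \<le> 5"
  unfolding max_degree_def
proof (rule Max.boundedI)
  show "finite (degree (tree_path h p) ` verts (tree_path h p))"
    "degree (tree_path h p) ` verts (tree_path h p) \<noteq> {}"
    using simple_tree_path[OF assms] by (auto simp: simple_graph_def)
  fix a assume "a \<in> degree (tree_path h p) ` verts (tree_path h p)"
  then obtain v where a: "a = degree (tree_path h p) v" by blast
  define c r where "c = v div p" and "r = v mod p"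
  \<comment> \<open>Two neighbours on the path, the parent, and the two children. Candidates outside
    the graph, as at path ends or leaves, do no harm to an upper bound.\<close>
  let ?N = "[{v, Suc v}, {v, v - 1}, {v, (c div 2) * p + r}, {v, (2 * c) * p + r}, {v, (2 * c + 1) * p + r}]"
  have "{e \<in> edges (tree_path h p). v \<in> e} \<subseteq> set ?N"
  proof
    fix e assume "e \<in> {e \<in> edges (tree_path h p). v \<in> e}"
    then obtain x y where e: "e = {x, y}" "adj p x y" "v = x \<or> v = y"
      by (auto simp: tree_path_def)
    from e(3) show "e \<in> set ?N"
    proof
      assume v: "v = x"
      have "y = Suc v \<or> y = (2 * c) * p + r \<or> y = (2 * c + 1) * p + r"
      proof (cases "y = Suc v")
        case False
        then have y: "y mod p = r" "c = y div p div 2" using e(2) v by (auto simp: adj_def c_def r_def)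
        have "y div p = 2 * c \<or> y div p = 2 * c + 1" using y(2) by linarith
        then show ?thesis using y(1) div_mult_mod_eq[of y p] by metis
      qed simp
      then show ?thesis unfolding e(1) v by auto
    next
      assume v: "v = y"
      have "x = v - 1 \<or> x = (c div 2) * p + r"
      proof (cases "y = Suc x")
        case False
        then have "x mod p = r" "x div p = c div 2" using e(2) v by (auto simp: adj_def c_def r_def)
        then show ?thesis using div_mult_mod_eq[of x p] by metis
      qed (simp add: v)
      then show ?thesis unfolding e(1) v by auto
    qed
  qed
  then have "a \<le> card (set ?N)" unfolding a degree_def by (intro card_mono) auto
  also have "\<dots> \<le> length ?N" by (rule card_length)
  finally show "a \<le> 5" by simp
qed

section \<open>Tree decomposition\<close>

text \<open>A walk from \<open>u\<close> to \<open>r\<close> is continued by the reverse of a walk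
  from \<open>v\<close> to \<open>r\<close>; \<open>z\<close> is that reverse without its first
  vertex \<open>r\<close>, which already ends \<open>p\<close>.\<close>

lemma connected_from_root:
  assumes "\<And>u. u \<in> verts G \<Longrightarrow> \<exists>p. walk G p \<and> hd p = u \<and> last p = r"
  shows "connected_graph G"
  unfolding connected_graph_def
proof (intro ballI)
  fix u v assume "u \<in> verts G" "v \<in> verts G"
  then obtain p q where p: "walk G p" "hd p = u" "last p = r" and q: "walk G q" "hd q = v" "last q = r"
    using assms by meson
  have "q \<noteq> []" using q(1) by (simp add: walk_def)
  then obtain z where z: "rev q = r # z" using q(3) by (metis hd_rev list.collapse rev_is_Nil_conv)
  have "successively (\<lambda>u v. {u, v} \<in> edges G) (rev q)"
    using q(1) by (simp add: walk_def insert_commute)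
  then have "successively (\<lambda>u v. {u, v} \<in> edges G) (p @ z)"
    using p unfolding z walk_def by (cases z) (auto simp: successively_append_iff)
  moreover have "set z \<subseteq> verts G" 
    using q(1) z set_rev[of q] unfolding walk_def by (metis list.set_intros(2) subset_iff)
  ultimately have "walk G (p @ z)" using p(1) by (simp add: walk_def)
  moreover have "hd (p @ z) = u" using p(1,2) by (simp add: walk_def)
  moreover have "last (p @ z) = v"
  proof -
    have "last (rev q) = v" using q(2) \<open>q \<noteq> []\<close> by (simp add: last_rev)
    then show ?thesis using z p(3) by (cases "z = []") auto
  qed
  ultimately show "\<exists>p. walk G p \<and> hd p = u \<and> last p = v" by blast
qed

lemma heap_tree_edge: "{a, b} \<in> edges (heap_tree h) \<Longrightarrow> b < a \<Longrightarrow> b = a div 2"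
  by (auto simp: heap_tree_def doubleton_eq_iff)

lemma tree_heap_tree:
  assumes "h > 0"
  shows "tree (heap_tree h)"
  unfolding tree_def
proof (intro conjI)
  have "(1::nat) < 2 ^ h" using assms by (intro one_less_power) auto
  then have one: "1 \<in> verts (heap_tree h)" by (simp add: heap_tree_def)
  show "simple_graph (heap_tree h)"
    using one unfolding simple_graph_def by (auto simp: heap_tree_def card_insert_if)
  show "connected_graph (heap_tree h)"
  proof (rule connected_from_root)
    fix u assume "u \<in> verts (heap_tree h)"
    then show "\<exists>p. walk (heap_tree h) p \<and> hd p = u \<and> last p = 1"
    proof (induction u rule: less_induct)
      case (less u)
      show ?case
      proof (cases "u = 1")
        case True
        then show ?thesis using one by (intro exI[of _ "[1]"]) (simp add: walk_def)
      next
        case False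
        then have u: "u \<in> {2..<2 ^ h}" using less.prems by (auto simp: heap_tree_def)
        then have "u div 2 \<in> verts (heap_tree h)" "u div 2 < u" by (auto simp: heap_tree_def)
        then obtain p where p: "walk (heap_tree h) p" "hd p = u div 2" "last p = 1"
          using less.IH by blast
        have "{u, u div 2} \<in> edges (heap_tree h)" using u unfolding heap_tree_def by auto
        then have "walk (heap_tree h) (u # p)"
          using p less.prems by (cases p) (simp_all add: walk_def)
        then show ?thesis using p by (intro exI[of _ "u # p"]) (simp add: walk_def)
      qed
    qed
  qed
  text \<open>The largest vertex of a cycle would have two distinct smaller neighbours.\<close>
  show "\<nexists>p. cycle (heap_tree h) p"
  proof
    assume "\<exists>p. cycle (heap_tree h) p"
    then obtain p where p: "walk (heap_tree h) p" "distinct p" "length p \<ge> 3"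
      "{last p, hd p} \<in> edges (heap_tree h)"
      unfolding cycle_def by blast
    have ne: "p \<noteq> []" using p(3) by auto
    then have "Max (set p) \<in> set p" by simp
    then obtain i where i: "i < length p" "p ! i = Max (set p)" by (auto simp: in_set_conv_nth)
    have step: "{p ! k, p ! Suc k} \<in> edges (heap_tree h)" if "Suc k < length p" for k
      using p(1) that unfolding walk_def successively_conv_nth by blast
    have nbr: "p ! j = p ! i div 2"
      if "j < length p" "j \<noteq> i" "{p ! i, p ! j} \<in> edges (heap_tree h)" for j
    proof (rule heap_tree_edge[OF that(3)])
      have "p ! j \<le> p ! i" unfolding i(2) using that(1) by simp
      moreover have "p ! j \<noteq> p ! i" using p(2) that(1,2) i(1) by (simp add: nth_eq_iff_index_eq)
      ultimately show "p ! j < p ! i" by simp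
    qed
    \<comment> \<open>\<open>j\<close> and \<open>k\<close> are the cyclic predecessor and successor
      of position \<open>i\<close>; they differ because the cycle has length at least 3.\<close>
    define j where "j = (if i = 0 then length p - 1 else i - 1)"
    define k where "k = (if Suc i = length p then 0 else Suc i)"
    have wrap: "{p ! (length p - 1), p ! 0} \<in> edges (heap_tree h)"
      using p(4) ne by (simp add: last_conv_nth hd_conv_nth)
    have jk: "j < length p" "j \<noteq> i" "k < length p" "k \<noteq> i" "j \<noteq> k"
      using i(1) p(3) by (auto simp: j_def k_def)
    have "{p ! i, p ! j} \<in> edges (heap_tree h)"
      using wrap step[of "i - 1"] i(1) by (cases i) (auto simp: j_def insert_commute)
    moreover have "{p ! i, p ! k} \<in> edges (heap_tree h)"
    proof (cases "Suc i = length p")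
      case True
      then have "i = length p - 1" by simp
      then show ?thesis using wrap True by (simp add: k_def)
    next
      case False
      then show ?thesis using step[of i] i(1) by (simp add: k_def)
    qed
    ultimately have "p ! j = p ! k" using nbr jk by metis
    then show False using p(2) jk by (simp add: nth_eq_iff_index_eq)
  qed
qed

lemma treewidth_tree_path:
  assumes p: "p > 0" and h: "h > 0"
  shows "treewidth (tree_path h p) \<le> 2 * p - 1"
proof -
  let ?G = "tree_path h p" and ?T = "heap_tree h"
  \<comment> \<open>At the root, \<open>t div 2\<close> is 0, which carries no vertices of the
    graph, so the bag is a single path.\<close>
  define B where "B t = {v \<in> verts ?G. v div p = t \<or> v div p = t div 2}" for t
  have block: "v div p \<in> verts ?T" if "v \<in> verts ?G" for v
    using that by (simp add: tree_path_def heap_tree_def blocks_def)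
  have "tree_decomposition ?G ?T B"
    unfolding tree_decomposition_def
  proof (intro conjI ballI)
    show "tree ?T" by (rule tree_heap_tree[OF h])
    show "(\<Union>t\<in>verts ?T. B t) = verts ?G" using block unfolding B_def by blast
  next
    fix e assume "e \<in> edges ?G"
    then obtain v w where e: "e = {v, w}" "adj p v w" "v \<in> verts ?G" "w \<in> verts ?G"
      unfolding tree_path_def by auto
    have "v div p = w div p \<or> v div p = w div p div 2" using e(2) unfolding adj_def by blast
    \<comment> \<open>In \<open>adj\<close>, \<open>w\<close> is the child end, and the bag at its
      node also holds the path of the parent.\<close>
    then have "e \<subseteq> B (w div p)" using e unfolding B_def by simp
    then show "\<exists>t\<in>verts ?T. e \<subseteq> B t" using block[OF e(4)] by blast
  next
    fix v assume v: "v \<in> verts ?G"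
    let ?H = "induced_subgraph ?T {t \<in> verts ?T. v \<in> B t}"
    have c: "v div p \<in> verts ?H" using v block by (simp add: induced_subgraph_def B_def)
    show "connected_graph ?H"
    \<comment> \<open>The bags containing \<open>v\<close> sit at its own node and at the children
      of that node: a star.\<close>
    proof (rule connected_from_root)
      fix t assume t: "t \<in> verts ?H"
      show "\<exists>q. walk ?H q \<and> hd q = t \<and> last q = v div p"
      proof (cases "t = v div p")
        case True
        then show ?thesis using c by (intro exI[of _ "[t]"]) (simp add: walk_def)
      next
        case False
        then have t2: "v div p = t div 2" "t \<in> verts ?T"
          using t by (auto simp: induced_subgraph_def B_def)
        have "v div p \<noteq> 0" using block[OF v] by (simp add: heap_tree_def)
        then have "t \<in> {2..<2 ^ h}" using t2 by (auto simp: heap_tree_def)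
        then have "{t, v div p} \<in> edges ?T" unfolding t2(1) heap_tree_def by auto
        then have "{t, v div p} \<in> edges ?H" using t c by (simp add: induced_subgraph_def)
        then show ?thesis using t c by (intro exI[of _ "[t, v div p]"]) (simp add: walk_def)
      qed
    qed
  qed
  then have "treewidth ?G \<le> decomposition_width ?T B"
    unfolding treewidth_def by (intro Least_le) blast
  also have "\<dots> \<le> 2 * p - 1"
    unfolding decomposition_width_def
  proof (intro diff_le_mono Max.boundedI)
    have T: "simple_graph ?T" using tree_heap_tree[OF h] by (simp add: tree_def)
    then show "finite ((\<lambda>t. card (B t)) ` verts ?T)" "(\<lambda>t. card (B t)) ` verts ?T \<noteq> {}"
      by (auto simp: simple_graph_def)
    fix a assume "a \<in> (\<lambda>t. card (B t)) ` verts ?T"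
    then obtain t where a: "a = card (B t)" by blast
    have "card (B t) \<le> card (blocks p {t, t div 2})"
      by (rule card_mono[OF finite_blocks(1)[OF p]]) (auto simp: B_def blocks_def)
    also have "\<dots> = card {t, t div 2} * p" by (rule finite_blocks(2)[OF p]) simp
    also have "\<dots> \<le> 2 * p" by (intro mult_right_mono) (simp_all add: card_insert_if)
    finally show "a \<le> 2 * p" unfolding a .
  qed
  finally show ?thesis .
qed

section \<open>Vertex count and the final estimate\<close>

lemma card_tree_path: "p > 0 \<Longrightarrow> card (verts (tree_path h p)) = (2 ^ h - 1) * p"
  using finite_blocks(2)[of p "{1..<2 ^ h}"] by (simp add: tree_path_def)

text \<open>Since \<open>p < 2 ^ p\<close>, the path factor adds at most \<open>p\<close> to the
  logarithm.\<close>

lemma log_card_tree_path: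
  assumes "p > 0" "h > 0"
  shows "log 2 (card (verts (tree_path h p))) \<le> h + p"
proof -
  have "(2::nat) ^ 1 \<le> 2 ^ h" using assms(2) by (intro power_increasing) auto
  then have "0 < (2 ^ h - 1) * p" using assms(1) by simp
  moreover have "(2 ^ h - 1) * p \<le> 2 ^ h * 2 ^ p"
    by (intro mult_mono) (auto intro: less_imp_le less_exp)
  then have "(2 ^ h - 1) * p \<le> 2 ^ (h + p)" by (simp only: power_add)
  then have "real ((2 ^ h - 1) * p) \<le> real (2 ^ (h + p))" by (simp only: of_nat_le_iff)
  ultimately have "log 2 (real ((2 ^ h - 1) * p)) \<le> log 2 (real (2 ^ (h + p)))"
    by (intro log_mono) (simp_all only: of_nat_0_less_iff one_less_numeral_iff, simp)
  also have "\<dots> = real (h + p)" by (simp add: log_nat_power)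
  finally show ?thesis unfolding card_tree_path[OF assms(1)] by simp
qed

theorem theorem3:
  shows "\<exists>b::real. b > 0 \<and>
    (\<forall>k::nat. k \<ge> 3 \<longrightarrow>
      (\<exists>\<G> :: nat ugraph set.
         infinite \<G> \<and>
         (\<forall>G\<in>\<G>. \<forall>H\<in>\<G>. isomorphic G H \<longrightarrow> G = H) \<and>
         (\<forall>G\<in>\<G>. simple_graph G \<and> max_degree G \<le> 5 \<and> treewidth G \<le> k \<and>
            real (mw G) \<ge> log 2 (real (card (verts G))) * real k / b)))"
proof (intro exI[of _ 8] conjI allI impI)
  fix k :: nat assume k: "k \<ge> 3"
  \<comment> \<open>Half of \<open>k\<close>, rounded up: \<open>2 * p - 1 \<le> k\<close> serves
    the treewidth bound, \<open>k \<le> 2 * p\<close> the matching width bound.\<close>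
  define p where "p = (k + 1) div 2"
  have p: "p > 0" "2 * p - 1 \<le> k" "k \<le> 2 * p" using k by (auto simp: p_def)
  define F where "F j = tree_path (p + 1 + 2 * j) p" for j
  \<comment> \<open>The vertex count determines the index; this yields both infinitely many graphs
    and pairwise non-isomorphism.\<close>
  have same_card: "i = j" if "card (verts (F i)) = card (verts (F j))" for i j
  proof -
    have "(2::nat) ^ (p + 1 + 2 * i) - 1 = 2 ^ (p + 1 + 2 * j) - 1"
      using that p(1) unfolding F_def card_tree_path[OF p(1)] by simp
    then have "(2::nat) ^ (p + 1 + 2 * i) = 2 ^ (p + 1 + 2 * j)"
      by (metis Suc_diff_1 zero_less_numeral zero_less_power)
    then show ?thesis by simp
  qed
  have "inj F" by (rule injI, rule same_card) simp
  \<comment> \<open>Indices start at \<open>p + 1\<close> so that the bound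
    \<open>2 * p + 1 + 2 * j\<close> on the logarithm is at most \<open>4 * j\<close>.\<close>
  then have inf: "infinite (F ` {p + 1..})"
    by (simp add: finite_image_iff inj_on_subset infinite_Ici)
  have iso: "G = H" if GH: "G \<in> F ` {p + 1..}" "H \<in> F ` {p + 1..}" "isomorphic G H" for G H
  proof -
    obtain i j where ij: "G = F i" "H = F j" using GH(1,2) by blast
    have "card (verts G) = card (verts H)"
      using GH(3) bij_betw_same_card unfolding isomorphic_def by blast
    then have "i = j" unfolding ij by (rule same_card)
    then show ?thesis using ij by simp
  qed
  have props: "simple_graph (F j) \<and> max_degree (F j) \<le> 5 \<and> treewidth (F j) \<le> k \<and>
      real (mw (F j)) \<ge> log 2 (real (card (verts (F j)))) * real k / 8" if j: "j \<ge> p + 1" for j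
  proof (intro conjI)
    show "simple_graph (F j)" unfolding F_def by (rule simple_tree_path) (use p in auto)
    show "max_degree (F j) \<le> 5" unfolding F_def by (rule max_degree_tree_path) (use p in auto)
    show "treewidth (F j) \<le> k"
      using treewidth_tree_path[of p "p + 1 + 2 * j"] p unfolding F_def by linarith
    have "log 2 (real (card (verts (F j)))) \<le> real (p + 1 + 2 * j) + real p"
      using log_card_tree_path[of p "p + 1 + 2 * j"] p unfolding F_def by simp
    also have "\<dots> \<le> 4 * real j" using j by simp
    \<comment> \<open>The factors 4 and 2 multiply to the constant 8, leaving exactly
      \<open>p * j\<close>.\<close>
    finally have "log 2 (real (card (verts (F j)))) * real k \<le> (4 * real j) * (2 * real p)"
      using p(3) by (intro mult_mono) auto
    then have "log 2 (real (card (verts (F j)))) * real k / 8 \<le> real (p * j)" by (simp add: mult_ac)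
    also have "\<dots> \<le> real (mw (F j))" unfolding F_def of_nat_le_iff by (rule mw_tree_path[OF p(1)])
    finally show "real (mw (F j)) \<ge> log 2 (real (card (verts (F j)))) * real k / 8" .
  qed
  show "\<exists>\<G> :: nat ugraph set. infinite \<G> \<and>
         (\<forall>G\<in>\<G>. \<forall>H\<in>\<G>. isomorphic G H \<longrightarrow> G = H) \<and>
         (\<forall>G\<in>\<G>. simple_graph G \<and> max_degree G \<le> 5 \<and> treewidth G \<le> k \<and>
            real (mw G) \<ge> log 2 (real (card (verts G))) * real k / 8)"
    by (rule exI[of _ "F ` {p + 1..}"]) (use inf iso props in blast)
qed simp

end
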